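(* Let $f\in L^2(\Omega)$ and let $\alpha\in\mathbb{R}$. For all $\alpha\neq 0$, the equation: find $\phi_h\in V^0_h$ such that $$(\mathcal{L}^0_h+\alpha S^0_h)\,\phi_h=\tilde\Pi^0_h f$$ admits a unique solution $\phi_h$. This solution belongs to the conforming space $V^{0,c}_h=V^0_h\cap H^1_0(\Omega)$ and solves the conforming Poisson problem $$\langle \operatorname{grad}\varphi^c,\operatorname{grad}\phi_h\rangle=\langle\varphi^c,f\rangle\qquad\forall\,\varphi^c\in V^{0,c}_h .$$ In particular, $\phi_h$ is independent of both $\alpha$ and the specific projection $P^0_h$.
   Context: $\langle\cdot,\cdot\rangle$ is the $L^2(\Omega)$ scalar product and $A^*$ denotes the $L^2$-adjoint of a linear operator $A$ between the finite-dimensional spaces below. Let $\Omega\subset\mathbb{R}^3$ be a domain decomposed in a partition of open subdomains $\Omega_k$, $k=1,\dots,K$, and set $V^0=H^1_0(\Omega)$, $V^1=H_0(\operatorname{curl};\Omega)$. For each $k$ let $V^0_h(\Omega_k)\subset H^1(\Omega_k)$ and $V^1_h(\Omega_k)\subset H(\operatorname{curl};\Omega_k)$ be finite-dimensional spaces (no boundary conditions) with $\operatorname{grad}V^0_h(\Omega_k)\subset V^1_h(\Omega_k)$. The broken spaces are $$V^\ell_h:=\{v\in L^2(\Omega): v|_{\Omega_k}\in V^\ell_h(\Omega_k),\ k=1,\dots,K\}$$ (vector-valued for $\ell=1$), and the conforming spaces are $V^{\ell,c}_h:=V^\ell_h\cap V^\ell$; one has $\operatorname{grad}V^{0,c}_h\subset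 V^{1,c}_h$. The conforming projection $P^0_h:V^0_h\to V^0_h$ is a linear projection with range $V^{0,c}_h$. Operators: - $\operatorname{grad}_h:=\operatorname{grad}P^0_h:V^0_h\to V^1_h$. - $\widetilde{\operatorname{div}}_h:V^1_h\to V^0_h$ is defined by $\langle\widetilde{\operatorname{div}}_h v,\varphi\rangle=-\langle v,\operatorname{grad}P^0_h\varphi\rangle$ for all $v\in V^1_h$, $\varphi\in V^0_h$. - $\mathcal{L}^0_h:=-\widetilde{\operatorname{div}}_h\operatorname{grad}_h:V^0_h\to V^0_h$. - $S^0_h:=(I-P^0_h)^*(I-P^0_h):V^0_h\to V^0_h$. - $\tilde\Pi^0_h:L^2(\Omega)\to V^0_h$ is defined by $\langle\tilde\Pi^0_h f,\varphi\rangle=\langle f,P^0_h\varphi\rangle$ for all $\varphi\in V^0_h$. *)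

theory Defs
  imports "HOL-Analysis.Analysis"
begin

section \<open>The Hilbert space of square-integrable fields on three-space\<close>

definition square_integrable :: "(real^3 \<Rightarrow> 'b::euclidean_space) \<Rightarrow> bool" where
  "square_integrable f \<longleftrightarrow> f \<in> borel_measurable lborel \<and> integrable lborel (\<lambda>x. (norm (f x))\<^sup>2)"

definition l2_eq :: "(real^3 \<Rightarrow> 'b::euclidean_space) \<Rightarrow> (real^3 \<Rightarrow> 'b) \<Rightarrow> bool" where
  "l2_eq f g \<longleftrightarrow> square_integrable f \<and> square_integrable g \<and> (AE x in lborel. f x = g x)"

lemma square_integrable_zero: "square_integrable (\<lambda>x. 0)"
  by (simp add: square_integrable_def)

lemma square_integrable_add:
  assumes "square_integrable f" "square_integrable g"
  shows "square_integrable (\<lambda>x. f x + g x)"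
proof -
  have [measurable]: "f \<in> borel_measurable lborel" "g \<in> borel_measurable lborel"
    using assms by (auto simp: square_integrable_def)
  have "integrable lborel (\<lambda>x. 2 * (norm (f x))\<^sup>2 + 2 * (norm (g x))\<^sup>2)"
    using assms by (auto simp: square_integrable_def)
  then have "integrable lborel (\<lambda>x. (norm (f x + g x))\<^sup>2)"
  proof (rule Bochner_Integration.integrable_bound)
    show "AE x in lborel. norm ((norm (f x + g x))\<^sup>2)
        \<le> norm (2 * (norm (f x))\<^sup>2 + 2 * (norm (g x))\<^sup>2)"
    proof (rule AE_I2)
      fix x
      have "(norm (f x + g x))\<^sup>2 \<le> (norm (f x) + norm (g x))\<^sup>2"
        by (simp add: norm_triangle_ineq power_mono)
      also have "\<dots> \<le> 2 * (norm (f x))\<^sup>2 + 2 * (norm (g x))\<^sup>2"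
        using sum_squares_bound[of "norm (f x)" "norm (g x)"] by (simp add: power2_sum)
      finally show "norm ((norm (f x + g x))\<^sup>2)
          \<le> norm (2 * (norm (f x))\<^sup>2 + 2 * (norm (g x))\<^sup>2)" by simp
    qed
  qed simp
  then show ?thesis by (simp add: square_integrable_def)
qed

lemma square_integrable_scaleR:
  assumes "square_integrable f"
  shows "square_integrable (\<lambda>x. c *\<^sub>R f x)"
  using assms by (auto simp: square_integrable_def power_mult_distrib)

lemma integrable_inner_square_integrable:
  assumes "square_integrable f" "square_integrable g"
  shows "integrable lborel (\<lambda>x. f x \<bullet> g x)"
proof -
  have [measurable]: "f \<in> borel_measurable lborel" "g \<in> borel_measurable lborel"
    using assms by (auto simp: square_integrable_def)
  have "integrable lborel (\<lambda>x. (norm (f x))\<^sup>2 + (norm (g x))\<^sup>2)"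
    using assms by (auto simp: square_integrable_def)
  then show ?thesis
  proof (rule Bochner_Integration.integrable_bound)
    show "AE x in lborel. norm (f x \<bullet> g x) \<le> norm ((norm (f x))\<^sup>2 + (norm (g x))\<^sup>2)"
    proof (rule AE_I2)
      fix x
      have "\<bar>f x \<bullet> g x\<bar> \<le> norm (f x) * norm (g x)" by (rule Cauchy_Schwarz_ineq2)
      also have "\<dots> \<le> (norm (f x))\<^sup>2 + (norm (g x))\<^sup>2"
        using sum_squares_bound[of "norm (f x)" "norm (g x)"]
          mult_nonneg_nonneg[OF norm_ge_zero norm_ge_zero, of "f x" "g x"] by linarith
      finally show "norm (f x \<bullet> g x) \<le> norm ((norm (f x))\<^sup>2 + (norm (g x))\<^sup>2)" by simp
    qed
  qed simp
qed

quotient_type (overloaded) 'b l2 = "real^3 \<Rightarrow> 'b::euclidean_space" / partial: l2_eq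
  morphisms fn to_l2
proof (rule part_equivpI)
  show "\<exists>f::real^3 \<Rightarrow> 'b. l2_eq f f"
    using square_integrable_zero by (auto simp: l2_eq_def)
  show "symp (l2_eq :: (real^3 \<Rightarrow> 'b) \<Rightarrow> _)"
    by (auto simp: symp_def l2_eq_def elim: eventually_mono)
  show "transp (l2_eq :: (real^3 \<Rightarrow> 'b) \<Rightarrow> _)"
    unfolding transp_def l2_eq_def by (auto elim: eventually_elim2)
qed

instantiation l2 :: (euclidean_space) real_vector
begin

lift_definition zero_l2 :: "'a l2" is "\<lambda>x. 0"
  using square_integrable_zero by (auto simp: l2_eq_def)

lift_definition plus_l2 :: "'a l2 \<Rightarrow> 'a l2 \<Rightarrow> 'a l2" is "\<lambda>f g x. f x + g x"
  unfolding l2_eq_def by (auto intro: square_integrable_add elim: eventually_elim2)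

lift_definition scaleR_l2 :: "real \<Rightarrow> 'a l2 \<Rightarrow> 'a l2" is "\<lambda>c f x. c *\<^sub>R f x"
  unfolding l2_eq_def by (auto intro: square_integrable_scaleR elim: eventually_mono)

lift_definition uminus_l2 :: "'a l2 \<Rightarrow> 'a l2" is "\<lambda>f x. - f x"
  unfolding l2_eq_def square_integrable_def by (auto elim: eventually_mono)

definition minus_l2 :: "'a l2 \<Rightarrow> 'a l2 \<Rightarrow> 'a l2" where "minus_l2 u v = u + - v"

instance
proof
  fix u v w :: "'a l2" and a b :: real
  show "u + v + w = u + (v + w)"
    by transfer (auto simp: l2_eq_def add.assoc intro!: square_integrable_add)
  show "u + v = v + u"
    by transfer (auto simp: l2_eq_def add.commute intro!: square_integrable_add)
  show "0 + u = u" by transfer (auto simp: l2_eq_def)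
  show "- u + u = 0" 
    by transfer (auto simp: l2_eq_def intro: square_integrable_zero)
  show "u - v = u + - v" by (simp add: minus_l2_def)
  show "a *\<^sub>R (u + v) = a *\<^sub>R u + a *\<^sub>R v"
    by transfer
      (auto simp: l2_eq_def scaleR_add_right intro!: square_integrable_add square_integrable_scaleR)
  show "(a + b) *\<^sub>R u = a *\<^sub>R u + b *\<^sub>R u"
    by transfer
      (auto simp: l2_eq_def scaleR_add_left intro!: square_integrable_add square_integrable_scaleR)
  show "a *\<^sub>R b *\<^sub>R u = (a * b) *\<^sub>R u"
    by transfer (auto simp: l2_eq_def intro!: square_integrable_scaleR)
  show "1 *\<^sub>R u = u" by transfer (auto simp: l2_eq_def)
qed

end

instantiation l2 :: (euclidean_space) real_inner
begin

lift_definition inner_l2 :: "'a l2 \<Rightarrow> 'a l2 \<Rightarrow> real" is "\<lambda>f g. \<integral>x. f x \<bullet> g x \<partial>lborel"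
proof -
  fix f f' g g' :: "real^3 \<Rightarrow> 'a"
  assume A: "l2_eq f f'" "l2_eq g g'"
  have [measurable]: "f \<in> borel_measurable lborel" "g \<in> borel_measurable lborel"
     "f' \<in> borel_measurable lborel" "g' \<in> borel_measurable lborel"
    using A by (auto simp: square_integrable_def l2_eq_def)
  show "(\<integral>x. f x \<bullet> g x \<partial>lborel) = (\<integral>x. f' x \<bullet> g' x \<partial>lborel)"
    by (rule integral_cong_AE) (use A in \<open>auto simp: l2_eq_def elim: eventually_elim2\<close>)
qed

definition norm_l2 :: "'a l2 \<Rightarrow> real" where "norm_l2 u = sqrt (u \<bullet> u)"
definition sgn_l2 :: "'a l2 \<Rightarrow> 'a l2" where "sgn_l2 u = u /\<^sub>R norm u"
definition dist_l2 :: "'a l2 \<Rightarrow> 'a l2 \<Rightarrow> real" where "dist_l2 u v = norm (u - v)"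
definition uniformity_l2 :: "('a l2 \<times> 'a l2) filter" where
  "uniformity_l2 = (INF e\<in>{0<..}. principal {(u, v). dist u v < e})"
definition open_l2 :: "'a l2 set \<Rightarrow> bool" where
  "open_l2 U \<longleftrightarrow> (\<forall>u\<in>U. \<forall>\<^sub>F (u', v) in uniformity. u' = u \<longrightarrow> v \<in> U)"

instance
proof
  fix u v w :: "'a l2" and a :: real
  show "u \<bullet> v = v \<bullet> u" by transfer (simp add: inner_commute)
  show "(u + v) \<bullet> w = u \<bullet> w + v \<bullet> w"
    by transfer
      (simp add: l2_eq_def inner_add_left Bochner_Integration.integral_add
        integrable_inner_square_integrable)
  show "(a *\<^sub>R u) \<bullet> v = a * (u \<bullet> v)" by transfer simp
  show "0 \<le> u \<bullet> u" by transfer simp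
  show "u \<bullet> u = 0 \<longleftrightarrow> u = 0"
  proof transfer
    fix f :: "real^3 \<Rightarrow> 'a" assume "l2_eq f f"
    then have f: "square_integrable f" by (simp add: l2_eq_def)
    have "(\<integral>x. f x \<bullet> f x \<partial>lborel) = 0 \<longleftrightarrow> (AE x in lborel. f x \<bullet> f x = 0)"
      by (rule integral_nonneg_eq_0_iff_AE)
        (use integrable_inner_square_integrable[OF f f] in auto)
    then show "(\<integral>x. f x \<bullet> f x \<partial>lborel) = 0 \<longleftrightarrow> l2_eq f (\<lambda>x. 0)"
      using f square_integrable_zero by (auto simp: l2_eq_def)
  qed
  show "norm u = sqrt (u \<bullet> u)" by (simp add: norm_l2_def)
  show "sgn u = u /\<^sub>R norm u" by (simp add: sgn_l2_def)
  show "dist u v = norm (u - v)" by (simp add: dist_l2_def)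
  show "(uniformity :: ('a l2 \<times> 'a l2) filter) = (INF e\<in>{0<..}. principal {(u, v). dist u v < e})"
    by (simp add: uniformity_l2_def)
  show "open U \<longleftrightarrow> (\<forall>u\<in>U. \<forall>\<^sub>F (u', v) in uniformity. u' = u \<longrightarrow> v \<in> U)" for U :: "'a l2 set"
    by (simp add: open_l2_def)
qed

end

lemma inner_to_l2:
  assumes "square_integrable f" "square_integrable g"
  shows "to_l2 f \<bullet> to_l2 g = (\<integral>x. f x \<bullet> g x \<partial>lborel)"
  using assms by (intro inner_l2.abs_eq) (auto simp: l2_eq_def)

lemma to_l2_eq_iff:
  assumes "square_integrable f" "square_integrable g"
  shows "to_l2 f = to_l2 g \<longleftrightarrow> (AE x in lborel. f x = g x)"
  using assms Quotient3_rel[OF Quotient3_l2, of f g] by (auto simp: l2_eq_def)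

text \<open>Functions on a domain \<open>D\<close> are identified with their extension by zero.  Under this
  identification the scalar product of \<open>L\<^sup>2(D)\<close> is the one of the ambient space.\<close>

definition L2_on :: "(real^3) set \<Rightarrow> 'b::euclidean_space l2 set" where
  "L2_on D = {u. AE x in lborel. x \<notin> D \<longrightarrow> fn u x = 0}"

text \<open>Only meaningful for Borel \<open>D\<close>.\<close>

definition restr :: "(real^3) set \<Rightarrow> 'b::euclidean_space l2 \<Rightarrow> 'b l2" where
  "restr D u = to_l2 (\<lambda>x. indicator D x *\<^sub>R fn u x)"

section \<open>Sobolev spaces\<close>

definition partial :: "3 \<Rightarrow> (real^3 \<Rightarrow> 'b::real_normed_vector) \<Rightarrow> real^3 \<Rightarrow> 'b" where
  "partial i f x = frechet_derivative f (at x) (axis i 1)"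

primrec Ck :: "nat \<Rightarrow> (real^3 \<Rightarrow> 'b::real_normed_vector) \<Rightarrow> bool" where
  "Ck 0 f \<longleftrightarrow> continuous_on UNIV f"
| "Ck (Suc n) f \<longleftrightarrow> f differentiable_on UNIV \<and> (\<forall>i. Ck n (partial i f))"

definition test_functions :: "(real^3) set \<Rightarrow> (real^3 \<Rightarrow> 'b::real_normed_vector) set" where
  "test_functions D =
    {f. (\<forall>n. Ck n f) \<and> compact (closure {x. f x \<noteq> 0}) \<and> closure {x. f x \<noteq> 0} \<subseteq> D}"

definition classical_grad :: "(real^3 \<Rightarrow> real) \<Rightarrow> real^3 \<Rightarrow> real^3" where
  "classical_grad f x = (\<chi> i. partial i f x)"

definition classical_div :: "(real^3 \<Rightarrow> real^3) \<Rightarrow> real^3 \<Rightarrow> real" where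
  "classical_div f x = (\<Sum>i\<in>UNIV. partial i f x $ i)"

definition classical_curl :: "(real^3 \<Rightarrow> real^3) \<Rightarrow> real^3 \<Rightarrow> real^3" where
  "classical_curl f x = vector
    [partial 2 f x $ 3 - partial 3 f x $ 2,
     partial 3 f x $ 1 - partial 1 f x $ 3,
     partial 1 f x $ 2 - partial 2 f x $ 1]"

definition has_weak_grad :: "(real^3) set \<Rightarrow> real l2 \<Rightarrow> (real^3) l2 \<Rightarrow> bool" where
  "has_weak_grad D u g \<longleftrightarrow> g \<in> L2_on D \<and>
    (\<forall>\<psi>\<in>test_functions D. u \<bullet> to_l2 (classical_div \<psi>) = - (g \<bullet> to_l2 \<psi>))"

definition has_weak_curl :: "(real^3) set \<Rightarrow> (real^3) l2 \<Rightarrow> (real^3) l2 \<Rightarrow> bool" where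
  "has_weak_curl D v c \<longleftrightarrow> c \<in> L2_on D \<and>
    (\<forall>\<psi>\<in>test_functions D. v \<bullet> to_l2 (classical_curl \<psi>) = c \<bullet> to_l2 \<psi>)"

definition grad :: "(real^3) set \<Rightarrow> real l2 \<Rightarrow> (real^3) l2" where
  "grad D u = (THE g. has_weak_grad D u g)"

definition H1 :: "(real^3) set \<Rightarrow> real l2 set" where
  "H1 D = {u \<in> L2_on D. \<exists>g. has_weak_grad D u g}"

definition Hcurl :: "(real^3) set \<Rightarrow> (real^3) l2 set" where
  "Hcurl D = {v \<in> L2_on D. \<exists>c. has_weak_curl D v c}"

text \<open>\<open>H10 D\<close> is the closure of the test functions in the norm of \<open>H1 D\<close>.\<close>

definition H10 :: "(real^3) set \<Rightarrow> real l2 set" where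
  "H10 D = {u \<in> H1 D. \<exists>\<phi>. (\<forall>n::nat. \<phi> n \<in> test_functions D) \<and>
     (\<lambda>n. to_l2 (\<phi> n)) \<longlonglongrightarrow> u \<and> (\<lambda>n. to_l2 (classical_grad (\<phi> n))) \<longlonglongrightarrow> grad D u}"

section \<open>Broken and conforming spaces\<close>

definition domain :: "(real^3) set \<Rightarrow> bool" where
  "domain D \<longleftrightarrow> open D \<and> connected D \<and> D \<noteq> {}"

text \<open>Two or more disjoint open sets cannot cover a connected \<open>\<Omega>\<close>; as usual for domain
  decompositions, the interfaces left out are a null set.\<close>

definition domain_partition :: "(real^3) set \<Rightarrow> nat \<Rightarrow> (nat \<Rightarrow> (real^3) set) \<Rightarrow> bool" where
  "domain_partition \<Omega> K D \<longleftrightarrow>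
     (\<forall>k\<in>{1..K}. domain (D k) \<and> D k \<subseteq> \<Omega>) \<and>
     disjoint_family_on D {1..K} \<and>
     negligible (\<Omega> - (\<Union>k\<in>{1..K}. D k))"

definition finite_dim_subspace :: "'a::real_vector set \<Rightarrow> bool" where
  "finite_dim_subspace V \<longleftrightarrow> subspace V \<and> (\<exists>B. finite B \<and> V \<subseteq> span B)"

definition broken_space ::
    "(real^3) set \<Rightarrow> nat \<Rightarrow> (nat \<Rightarrow> (real^3) set) \<Rightarrow> (nat \<Rightarrow> 'b::euclidean_space l2 set) \<Rightarrow> 'b l2 set"
  where
  "broken_space \<Omega> K D V = {v \<in> L2_on \<Omega>. \<forall>k\<in>{1..K}. restr (D k) v \<in> V k}"

definition conforming_space :: "(real^3) set \<Rightarrow> real l2 set \<Rightarrow> real l2 set" where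
  "conforming_space \<Omega> V0 = V0 \<inter> H10 \<Omega>"

definition linear_proj_onto :: "'a::real_vector set \<Rightarrow> 'a set \<Rightarrow> ('a \<Rightarrow> 'a) \<Rightarrow> bool" where
  "linear_proj_onto V W P \<longleftrightarrow>
     (\<forall>u\<in>V. \<forall>v\<in>V. P (u + v) = P u + P v) \<and> (\<forall>c. \<forall>u\<in>V. P (c *\<^sub>R u) = c *\<^sub>R P u) \<and>
     (\<forall>u\<in>V. P (P u) = P u) \<and> P ` V = W"

section \<open>Discrete operators\<close>

text \<open>\<open>V0\<close> is the broken scalar space.  All operators are total functions that are only meaningful
  on the stated domains; each THE below is a Riesz representative in a finite-dimensional space.\<close>

definition adjoint_on :: "'a::real_inner set \<Rightarrow> ('a \<Rightarrow> 'b::real_inner) \<Rightarrow> 'b \<Rightarrow> 'a" where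
  "adjoint_on V A w = (THE v. v \<in> V \<and> (\<forall>u\<in>V. v \<bullet> u = w \<bullet> A u))"

definition grad_h :: "(real^3) set \<Rightarrow> (real l2 \<Rightarrow> real l2) \<Rightarrow> real l2 \<Rightarrow> (real^3) l2" where
  "grad_h \<Omega> P u = grad \<Omega> (P u)"

definition div_h ::
    "(real^3) set \<Rightarrow> real l2 set \<Rightarrow> (real l2 \<Rightarrow> real l2) \<Rightarrow> (real^3) l2 \<Rightarrow> real l2" where
  "div_h \<Omega> V0 P v = (THE d. d \<in> V0 \<and> (\<forall>\<phi>\<in>V0. d \<bullet> \<phi> = - (v \<bullet> grad \<Omega> (P \<phi>))))"

definition L_h :: "(real^3) set \<Rightarrow> real l2 set \<Rightarrow> (real l2 \<Rightarrow> real l2) \<Rightarrow> real l2 \<Rightarrow> real l2" where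
  "L_h \<Omega> V0 P u = - div_h \<Omega> V0 P (grad_h \<Omega> P u)"

definition S_h :: "real l2 set \<Rightarrow> (real l2 \<Rightarrow> real l2) \<Rightarrow> real l2 \<Rightarrow> real l2" where
  "S_h V0 P u = adjoint_on V0 (\<lambda>w. w - P w) (u - P u)"

definition Pi_h :: "real l2 set \<Rightarrow> (real l2 \<Rightarrow> real l2) \<Rightarrow> real l2 \<Rightarrow> real l2" where
  "Pi_h V0 P f = (THE p. p \<in> V0 \<and> (\<forall>\<phi>\<in>V0. p \<bullet> \<phi> = f \<bullet> P \<phi>))"

definition solves_broken_poisson ::
    "(real^3) set \<Rightarrow> real l2 set \<Rightarrow> (real l2 \<Rightarrow> real l2) \<Rightarrow> real \<Rightarrow> real l2 \<Rightarrow> real l2 \<Rightarrow> bool" where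
  "solves_broken_poisson \<Omega> V0 P \<alpha> f \<phi> \<longleftrightarrow>
     \<phi> \<in> V0 \<and> L_h \<Omega> V0 P \<phi> + \<alpha> *\<^sub>R S_h V0 P \<phi> = Pi_h V0 P f"

end

theory Submission
  imports Defs
begin

text \<open>
  Testing the discrete equation with \<open>u - P u\<close> annihilates every term except the stabilisation, so
  \<open>\<phi> = P \<phi>\<close>; what remains is the conforming Poisson problem, in which neither \<open>\<alpha>\<close> nor \<open>P\<close> occurs.
  That problem is solved by Riesz representation in the finite-dimensional image of the conforming
  space under the gradient, once the gradient is known to be linear and injective on functions of
  \<open>H\<^sup>1\<^sub>0\<close>.  Linearity follows from Green's formula for test functions.  Injectivity has to hold on
  unbounded domains as well, so the Poincare inequality is replaced by
  \<open>\<integral> \<phi>\<^sup>2 / (1 + x\<^sub>1\<^sup>2) \<le> \<pi> \<parallel>\<phi>\<parallel> \<parallel>\<nabla> \<phi>\<parallel>\<close>, which comes from integrating the divergence of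
  \<open>arctan (x\<^sub>1) \<phi>\<^sup>2 e\<^sub>1\<close>.
\<close>

section \<open>Finite-dimensional subspaces\<close>

text \<open>\<open>P\<close> and \<open>grad \<Omega>\<close> are total functions whose values are
  meaningful only on certain subspaces, so linearity is required relative to
  \<open>V\<close>.\<close>

definition linear_map_on :: "'a::real_vector set \<Rightarrow> ('a \<Rightarrow> 'b::real_vector) \<Rightarrow> bool" where
  "linear_map_on V F \<longleftrightarrow>
     (\<forall>u\<in>V. \<forall>v\<in>V. F (u + v) = F u + F v) \<and> (\<forall>c. \<forall>u\<in>V. F (c *\<^sub>R u) = c *\<^sub>R F u)"

lemma linear_map_on_add: "linear_map_on V F \<Longrightarrow> u \<in> V \<Longrightarrow> v \<in> V \<Longrightarrow> F (u + v) = F u + F v"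
  and linear_map_on_scaleR: "linear_map_on V F \<Longrightarrow> u \<in> V \<Longrightarrow> F (c *\<^sub>R u) = c *\<^sub>R F u"
  by (auto simp: linear_map_on_def)

lemma linear_map_on_diff:
  assumes "linear_map_on V F" "subspace V" "u \<in> V" "v \<in> V"
  shows "F (u - v) = F u - F v"
  using linear_map_on_add[OF assms(1), of u "(-1) *\<^sub>R v"]
    linear_map_on_scaleR[OF assms(1), of v "-1"] assms subspace_scale[OF assms(2), of v "-1"]
  by simp

lemma linear_map_on_zero:
  assumes "linear_map_on V F" "subspace V"
  shows "F 0 = 0"
  using linear_map_on_scaleR[OF assms(1), of 0 0] subspace_0[OF assms(2)] by simp

text \<open>The finite set in \<open>finite_dim_subspace\<close> may reach outside \<open>V\<close>.
  A maximal independent subset of \<open>V\<close> generates exactly \<open>V\<close>, and being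
  independent inside \<open>span B\<close> it is finite.\<close>

lemma finite_dim_subspace_span:
  assumes "finite_dim_subspace V"
  obtains C where "finite C" "span C = V"
proof -
  obtain B where V: "subspace V" and B: "finite B" "V \<subseteq> span B"
    using assms by (auto simp: finite_dim_subspace_def)
  obtain C where C: "C \<subseteq> V" "independent C" "V \<subseteq> span C"
    by (rule maximal_independent_subset)
  moreover have "finite C"
    using independent_span_bound[OF B(1) C(2)] C(1) B(2) by blast
  ultimately show thesis
    using that V by (metis span_minimal subset_antisym)
qed

lemma subspace_image_linear_map_on:
  assumes "linear_map_on V F" "subspace V"
  shows "subspace (F ` V)"
proof (rule subspaceI)
  show "0 \<in> F ` V"
    using linear_map_on_zero[OF assms] subspace_0[OF assms(2)] by force
next
  fix x y assume "x \<in> F ` V" "y \<in> F ` V"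
  then obtain u v where "u \<in> V" "x = F u" "v \<in> V" "y = F v" by blast
  then show "x + y \<in> F ` V"
    using linear_map_on_add[OF assms(1), of u v] subspace_add[OF assms(2), of u v] by force
next
  fix c x assume "x \<in> F ` V"
  then obtain u where "u \<in> V" "x = F u" by blast
  then show "c *\<^sub>R x \<in> F ` V"
    using linear_map_on_scaleR[OF assms(1), of u c] subspace_scale[OF assms(2), of u c] by force
qed

lemma finite_dim_subspace_image:
  assumes "linear_map_on V F" "finite_dim_subspace V"
  shows "finite_dim_subspace (F ` V)"
proof -
  have V: "subspace V" using assms(2) by (simp add: finite_dim_subspace_def)
  obtain C where C: "finite C" "span C = V"
    using assms(2) by (rule finite_dim_subspace_span)
  \<comment> \<open>The vectors of \<open>V\<close> whose image lies in the span of the image of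
    \<open>C\<close> form a subspace; as it contains \<open>C\<close>, it is all of
    \<open>V\<close>.\<close>
  have "subspace {u \<in> V. F u \<in> span (F ` C)}"
    using V linear_map_on_zero[OF assms(1) V] linear_map_on_add[OF assms(1)]
      linear_map_on_scaleR[OF assms(1)]
    by (auto intro!: subspaceI intro: subspace_0 subspace_add subspace_scale span_add span_scale
        simp: span_zero)
  moreover have "C \<subseteq> {u \<in> V. F u \<in> span (F ` C)}"
    using C(2) span_superset[of C] by (auto intro: span_base)
  ultimately have "V \<subseteq> {u \<in> V. F u \<in> span (F ` C)}"
    using C(2) span_minimal by metis
  then show ?thesis
    using subspace_image_linear_map_on[OF assms(1) V] C(1)
    by (auto simp: finite_dim_subspace_def intro!: exI[of _ "F ` C"])
qed

text \<open>Expansion along a finite orthogonal generating set gives an explicit representative.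
  Unique existence is what gives the THE-terms in \<open>div_h\<close>, \<open>adjoint_on\<close>
  and \<open>Pi_h\<close> their defining property.\<close>

lemma riesz_finite_dim:
  fixes V :: "'a::real_inner set"
  assumes V: "finite_dim_subspace V" and F: "linear_map_on V F"
  shows "\<exists>!v. v \<in> V \<and> (\<forall>u\<in>V. v \<bullet> u = F u)"
proof (rule ex_ex1I)
  have sV: "subspace V" using V by (simp add: finite_dim_subspace_def)
  obtain B where "finite B" "span B = V" using V by (rule finite_dim_subspace_span)
  then obtain C where C: "finite C" "span C = V" "pairwise orthogonal C"
    using basis_orthogonal[of B] by auto
  have CV: "C \<subseteq> V" using C(2) span_superset by blast
  define v where "v = (\<Sum>c\<in>C. (F c / (c \<bullet> c)) *\<^sub>R c)"
  have "v \<bullet> c = F c" if c: "c \<in> C" for c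
  proof -
    have "v \<bullet> c = (\<Sum>d\<in>C. if d = c then F c / (c \<bullet> c) * (c \<bullet> c) else 0)"
      unfolding v_def inner_sum_left
      using C(3) c by (intro sum.cong) (auto simp: pairwise_def orthogonal_def)
    also have "\<dots> = F c / (c \<bullet> c) * (c \<bullet> c)" using C(1) c by simp
    \<comment> \<open>\<open>C\<close> may contain 0, for which the quotient defaults to 0; this
      agrees with \<open>F 0 = 0\<close>.\<close>
    also have "\<dots> = F c" using linear_map_on_zero[OF F sV] by auto
    finally show ?thesis .
  qed
  then have "C \<subseteq> {u \<in> V. v \<bullet> u = F u}" using CV by auto
  moreover have "subspace {u \<in> V. v \<bullet> u = F u}"
    using sV linear_map_on_zero[OF F sV] linear_map_on_add[OF F] linear_map_on_scaleR[OF F]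
    by (auto intro!: subspaceI intro: subspace_0 subspace_add subspace_scale simp: inner_add_right)
  ultimately have "V \<subseteq> {u \<in> V. v \<bullet> u = F u}" using C(2) span_minimal by metis
  moreover have "v \<in> V"
    unfolding v_def using CV sV by (auto intro!: subspace_sum subspace_scale)
  ultimately show "\<exists>v. v \<in> V \<and> (\<forall>u\<in>V. v \<bullet> u = F u)" by blast
next
  fix v w assume "v \<in> V \<and> (\<forall>u\<in>V. v \<bullet> u = F u)" "w \<in> V \<and> (\<forall>u\<in>V. w \<bullet> u = F u)"
  moreover from this have "v - w \<in> V"
    using V by (auto simp: finite_dim_subspace_def intro: subspace_diff)
  ultimately have "(v - w) \<bullet> (v - w) = 0" by (simp add: inner_diff_left)
  then show "v = w" by simp
qed

lemma inner_eqD_on_subspace: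
  fixes V :: "'a::real_inner set"
  assumes "subspace V" "v \<in> V" "w \<in> V" "\<And>u. u \<in> V \<Longrightarrow> v \<bullet> u = w \<bullet> u"
  shows "v = w"
  using assms(4)[OF subspace_diff[OF assms(1-3)]]
  by (metis inner_diff_left inner_eq_zero_iff right_minus_eq)

section \<open>The discrete equation\<close>

text \<open>Each discrete operator yields the Riesz representative of a functional that is linear on
  \<open>V0\<close>, so pairing the operator equation with every \<open>u\<close> in
  \<open>V0\<close> unfolds it into variational form.\<close>

lemma solves_broken_poisson_iff_weak:
  assumes V: "finite_dim_subspace V0" and P: "linear_proj_onto V0 W P"
    and G: "linear_map_on W (grad \<Omega>)"
  shows "solves_broken_poisson \<Omega> V0 P \<alpha> f \<phi> \<longleftrightarrow>
    \<phi> \<in> V0 \<and> (\<forall>u\<in>V0. grad \<Omega> (P \<phi>) \<bullet> grad \<Omega> (P u) + \<alpha> * ((\<phi> - P \<phi>) \<bullet> (u - P u)) = f \<bullet> P u)"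
proof -
  have sV: "subspace V0" using V by (simp add: finite_dim_subspace_def)
  have PW: "P u \<in> W" if "u \<in> V0" for u using P that by (auto simp: linear_proj_onto_def)
  have Padd: "P (u + v) = P u + P v" if "u \<in> V0" "v \<in> V0" for u v
    using P that by (auto simp: linear_proj_onto_def)
  have Psc: "P (c *\<^sub>R u) = c *\<^sub>R P u" if "u \<in> V0" for c u
    using P that by (auto simp: linear_proj_onto_def)
  have L: "L_h \<Omega> V0 P \<phi> \<in> V0 \<and> (\<forall>u\<in>V0. L_h \<Omega> V0 P \<phi> \<bullet> u = grad \<Omega> (P \<phi>) \<bullet> grad \<Omega> (P u))"
  proof -
    have "linear_map_on V0 (\<lambda>u. - (grad_h \<Omega> P \<phi> \<bullet> grad \<Omega> (P u)))"
      using PW by (simp add: linear_map_on_def Padd Psc linear_map_on_add[OF G]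
          linear_map_on_scaleR[OF G] inner_add_right)
    \<comment> \<open>The minus sign in \<open>div_h\<close> cancels against the one in
      \<open>L_h\<close>, which leaves the plain inner product of two gradients.\<close>
    from theI'[OF riesz_finite_dim[OF V this]] show ?thesis
      using sV unfolding L_h_def div_h_def[symmetric]
      by (auto simp: grad_h_def intro: subspace_neg)
  qed
  have S: "S_h V0 P \<phi> \<in> V0 \<and> (\<forall>u\<in>V0. S_h V0 P \<phi> \<bullet> u = (\<phi> - P \<phi>) \<bullet> (u - P u))"
  proof -
    have "linear_map_on V0 (\<lambda>u. (\<phi> - P \<phi>) \<bullet> (u - P u))"
      by (simp add: linear_map_on_def Padd Psc inner_add_right inner_diff_right algebra_simps)
    from theI'[OF riesz_finite_dim[OF V this]] show ?thesis
      unfolding S_h_def adjoint_on_def .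
  qed
  have Pi: "Pi_h V0 P f \<in> V0 \<and> (\<forall>u\<in>V0. Pi_h V0 P f \<bullet> u = f \<bullet> P u)"
  proof -
    have "linear_map_on V0 (\<lambda>u. f \<bullet> P u)"
      by (simp add: linear_map_on_def Padd Psc inner_add_right)
    from theI'[OF riesz_finite_dim[OF V this]] show ?thesis
      unfolding Pi_h_def .
  qed
  \<comment> \<open>Both sides belong to \<open>V0\<close>, so their difference is itself an
    admissible test vector.\<close>
  have "L_h \<Omega> V0 P \<phi> + \<alpha> *\<^sub>R S_h V0 P \<phi> = Pi_h V0 P f \<longleftrightarrow>
      (\<forall>u\<in>V0. (L_h \<Omega> V0 P \<phi> + \<alpha> *\<^sub>R S_h V0 P \<phi>) \<bullet> u = Pi_h V0 P f \<bullet> u)"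
    using inner_eqD_on_subspace[OF sV, of "L_h \<Omega> V0 P \<phi> + \<alpha> *\<^sub>R S_h V0 P \<phi>" "Pi_h V0 P f"] L S Pi sV
    by (auto intro: subspace_add subspace_scale)
  then show ?thesis
    using L S Pi by (auto simp: solves_broken_poisson_def inner_add_left)
qed

text \<open>The equivalence reduces existence, uniqueness and independence of \<alpha> and
  \<open>P\<close> to one problem: its right-hand side mentions neither of them.\<close>

lemma solves_broken_poisson_iff_conforming:
  assumes V: "finite_dim_subspace V0" and P: "linear_proj_onto V0 W P" and W: "W \<subseteq> V0"
    and G: "linear_map_on W (grad \<Omega>)" and \<alpha>: "\<alpha> \<noteq> 0"
  shows "solves_broken_poisson \<Omega> V0 P \<alpha> f \<phi> \<longleftrightarrow>
    \<phi> \<in> W \<and> (\<forall>u\<in>W. grad \<Omega> \<phi> \<bullet> grad \<Omega> u = f \<bullet> u)"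
proof -
  have sV: "subspace V0" using V by (simp add: finite_dim_subspace_def)
  have P': "linear_map_on V0 P" using P by (auto simp: linear_proj_onto_def linear_map_on_def)
  have PW: "P u \<in> W" if "u \<in> V0" for u using P that by (auto simp: linear_proj_onto_def)
  have Pid: "P u = u" if "u \<in> W" for u using P that by (auto simp: linear_proj_onto_def)
  have sW: "subspace W"
    using subspace_image_linear_map_on[OF P' sV] P by (simp add: linear_proj_onto_def)
  note iff = solves_broken_poisson_iff_weak[OF V P G]
  show ?thesis
  proof
    assume "solves_broken_poisson \<Omega> V0 P \<alpha> f \<phi>"
    then have \<phi>: "\<phi> \<in> V0" and eq: "\<And>u. u \<in> V0 \<Longrightarrow>
        grad \<Omega> (P \<phi>) \<bullet> grad \<Omega> (P u) + \<alpha> * ((\<phi> - P \<phi>) \<bullet> (u - P u)) = f \<bullet> P u"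
      unfolding iff by auto
    have r: "\<phi> - P \<phi> \<in> V0" using \<phi> PW W sV by (auto intro: subspace_diff)
    have "P (\<phi> - P \<phi>) = 0"
      using linear_map_on_diff[OF P' sV \<phi>, of "P \<phi>"] Pid PW \<phi> W by auto
    \<comment> \<open>Let r be \<open>\<phi> - P \<phi>\<close>. Since \<open>P\<close> maps r to 0,
      testing with r kills the gradient term and the load and leaves \<alpha> times the squared norm
      of r equal to 0. The sign of \<alpha> is irrelevant; it only has to be nonzero.\<close>
    then have "\<phi> - P \<phi> = 0"
      using eq[OF r] \<alpha> linear_map_on_zero[OF G sW] by simp
    then have "\<phi> \<in> W" using PW[OF \<phi>] by simp
    \<comment> \<open>For \<open>u\<close> in \<open>W\<close> one has \<open>P u = u\<close>, so
      the stabilisation drops out and the equation restricts to the conforming one.\<close>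
    then show "\<phi> \<in> W \<and> (\<forall>u\<in>W. grad \<Omega> \<phi> \<bullet> grad \<Omega> u = f \<bullet> u)"
      using eq W by (force simp: Pid)
  next
    assume "\<phi> \<in> W \<and> (\<forall>u\<in>W. grad \<Omega> \<phi> \<bullet> grad \<Omega> u = f \<bullet> u)"
    \<comment> \<open>Now \<open>P \<phi> = \<phi>\<close>, so the stabilisation vanishes for every
      test function, and what remains is the conforming equation tested with \<open>P u\<close>, an
      element of \<open>W\<close>.\<close>
    then show "solves_broken_poisson \<Omega> V0 P \<alpha> f \<phi>"
      unfolding iff using W PW by (auto simp: Pid)
  qed
qed

text \<open>The bilinear form is the ambient inner product restricted to gradients. Injectivity lets
  the load be regarded as a functional of the gradient, and the representing gradient has exactly
  one potential in \<open>W\<close>.\<close>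

lemma conforming_poisson_ex1:
  fixes W :: "real l2 set"
  assumes W: "finite_dim_subspace W" and G: "linear_map_on W (grad \<Omega>)"
    and inj: "\<And>u. u \<in> W \<Longrightarrow> grad \<Omega> u = 0 \<Longrightarrow> u = 0"
  shows "\<exists>!\<phi>. \<phi> \<in> W \<and> (\<forall>u\<in>W. grad \<Omega> \<phi> \<bullet> grad \<Omega> u = f \<bullet> u)"
proof -
  have sW: "subspace W" using W by (simp add: finite_dim_subspace_def)
  have injW: "inj_on (grad \<Omega>) W"
  proof (rule inj_onI)
    fix u v assume "u \<in> W" "v \<in> W" "grad \<Omega> u = grad \<Omega> v"
    then show "u = v"
      using inj[of "u - v"] linear_map_on_diff[OF G sW] subspace_diff[OF sW] by simp
  qed
  \<comment> \<open>The load transported to the space of gradients along the inverse of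
    \<open>grad \<Omega>\<close> on \<open>W\<close>.\<close>
  define F where "F g = f \<bullet> the_inv_into W (grad \<Omega>) g" for g
  have F: "F (grad \<Omega> u) = f \<bullet> u" if "u \<in> W" for u
    using the_inv_into_f_f[OF injW that] by (simp add: F_def)
  have "linear_map_on (grad \<Omega> ` W) F"
    using sW by (auto simp: linear_map_on_def F inner_add_right subspace_add subspace_scale
        linear_map_on_add[OF G, symmetric] linear_map_on_scaleR[OF G, symmetric])
  from riesz_finite_dim[OF finite_dim_subspace_image[OF G W] this]
  obtain g where g: "g \<in> grad \<Omega> ` W" "\<And>h. h \<in> grad \<Omega> ` W \<Longrightarrow> g \<bullet> h = F h"
    and uniq: "\<And>g'. g' \<in> grad \<Omega> ` W \<Longrightarrow> \<forall>h\<in>grad \<Omega> ` W. g' \<bullet> h = F h \<Longrightarrow> g' = g"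
    by blast
  then obtain \<phi> where \<phi>: "\<phi> \<in> W" "g = grad \<Omega> \<phi>" by blast
  show ?thesis
  proof (rule ex1I[of _ \<phi>])
    show "\<phi> \<in> W \<and> (\<forall>u\<in>W. grad \<Omega> \<phi> \<bullet> grad \<Omega> u = f \<bullet> u)"
      using \<phi> g(2) by (auto simp: F)
  next
    fix \<psi> assume "\<psi> \<in> W \<and> (\<forall>u\<in>W. grad \<Omega> \<psi> \<bullet> grad \<Omega> u = f \<bullet> u)"
    then have "grad \<Omega> \<psi> = g" "\<psi> \<in> W" using uniq[of "grad \<Omega> \<psi>"] by (auto simp: F)
    then show "\<psi> = \<phi>" using \<phi> injW by (auto dest: inj_onD)
  qed
qed

section \<open>Broken spaces\<close>

lemma to_l2_fn: "to_l2 (fn u) = u"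
  by (rule Quotient3_abs_rep[OF Quotient3_l2])

lemma square_integrable_fn: "square_integrable (fn u)"
  using Quotient3_rep_reflp[OF Quotient3_l2, of u] by (simp add: l2_eq_def)

lemma to_l2_add:
  assumes "square_integrable f" "square_integrable g"
  shows "to_l2 (\<lambda>x. f x + g x) = to_l2 f + to_l2 g"
  using assms by (subst plus_l2.abs_eq) (auto simp: l2_eq_def)

lemma to_l2_scaleR:
  assumes "square_integrable f"
  shows "to_l2 (\<lambda>x. c *\<^sub>R f x) = c *\<^sub>R to_l2 f"
  using assms by (subst scaleR_l2.abs_eq) (auto simp: l2_eq_def)

lemma to_l2_cong_AE:
  assumes "square_integrable f" "square_integrable g" "AE x in lborel. f x = g x"
  shows "to_l2 f = to_l2 g"
  using assms to_l2_eq_iff by blast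

text \<open>\<open>fn\<close> selects one representative from each class, so it respects addition
  only up to a null set.\<close>

lemma fn_add_AE: "AE x in lborel. fn (u + v) x = fn u x + fn v x"
  using to_l2_eq_iff[OF square_integrable_fn square_integrable_add[OF square_integrable_fn square_integrable_fn],
      of "u + v" u v]
  by (simp add: to_l2_add square_integrable_fn to_l2_fn)

lemma fn_scaleR_AE: "AE x in lborel. fn (c *\<^sub>R u) x = c *\<^sub>R fn u x"
  using to_l2_eq_iff[OF square_integrable_fn square_integrable_scaleR[OF square_integrable_fn],
      of "c *\<^sub>R u" c u]
  by (simp add: to_l2_scaleR square_integrable_fn to_l2_fn)

lemma square_integrable_indicator:
  assumes "square_integrable f" "D \<in> sets borel"
  shows "square_integrable (\<lambda>x. indicator D x *\<^sub>R f x)"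
  unfolding square_integrable_def
proof
  have [measurable]: "f \<in> borel_measurable lborel" "D \<in> sets borel"
    using assms by (auto simp: square_integrable_def)
  show "(\<lambda>x. indicator D x *\<^sub>R f x) \<in> borel_measurable lborel" by measurable
  show "integrable lborel (\<lambda>x. (norm (indicator D x *\<^sub>R f x))\<^sup>2)"
    by (rule Bochner_Integration.integrable_bound[of _ "\<lambda>x. (norm (f x))\<^sup>2"])
       (use assms in \<open>auto simp: square_integrable_def split: split_indicator\<close>)
qed

lemma linear_restr:
  assumes D: "D \<in> sets borel"
  shows "linear (restr D)"
proof (rule linearI)
  note si = square_integrable_indicator[OF square_integrable_fn D]
  fix u v :: "'a l2" and c :: real
  show "restr D (u + v) = restr D u + restr D v"
    unfolding restr_def to_l2_add[OF si si, symmetric]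
    by (rule to_l2_cong_AE[OF si square_integrable_add[OF si si]])
       (use fn_add_AE[of u v] in eventually_elim, simp add: scaleR_add_right)
  show "restr D (c *\<^sub>R u) = c *\<^sub>R restr D u"
    unfolding restr_def to_l2_scaleR[OF si, symmetric]
    by (rule to_l2_cong_AE[OF si square_integrable_scaleR[OF si]])
       (use fn_scaleR_AE[of c u] in eventually_elim, simp)
qed

text \<open>Support in \<open>D\<close> becomes a fixed-point equation for a linear map, so that
  \<open>subspace_L2_on\<close> is a matter of linearity alone.\<close>

lemma L2_on_iff_restr:
  assumes "D \<in> sets borel"
  shows "u \<in> L2_on D \<longleftrightarrow> restr D u = u"
proof -
  have "restr D u = u \<longleftrightarrow> (AE x in lborel. indicator D x *\<^sub>R fn u x = fn u x)"
    using to_l2_eq_iff[OF square_integrable_indicator[OF square_integrable_fn assms] square_integrable_fn, of u u]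
    by (simp add: restr_def to_l2_fn)
  also have "\<dots> \<longleftrightarrow> (AE x in lborel. x \<notin> D \<longrightarrow> fn u x = 0)"
    by (rule AE_cong) (auto simp: indicator_def)
  finally show ?thesis by (simp add: L2_on_def)
qed

lemma subspace_L2_on:
  assumes "D \<in> sets borel"
  shows "subspace (L2_on D)"
  using linear_restr[OF assms, where 'a='a]
  by (auto intro!: subspaceI simp: L2_on_iff_restr[OF assms] linear_add linear_scale linear_0)

lemma square_integrable_sum:
  assumes "\<And>k. k \<in> I \<Longrightarrow> square_integrable (f k)"
  shows "square_integrable (\<lambda>x. \<Sum>k\<in>I. f k x)"
  using assms
  by (induction I rule: infinite_finite_induct)
     (auto intro: square_integrable_add square_integrable_zero)

lemma to_l2_sum:
  assumes "\<And>k. k \<in> I \<Longrightarrow> square_integrable (f k)"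
  shows "to_l2 (\<lambda>x. \<Sum>k\<in>I. f k x) = (\<Sum>k\<in>I. to_l2 (f k))"
  using assms
  by (induction I rule: infinite_finite_induct)
     (auto simp: to_l2_add square_integrable_sum zero_l2_def)

section \<open>Broken functions as sums of their local pieces\<close>

lemma domain_partition_sets_borel:
  assumes "domain_partition \<Omega> K D" "k \<in> {1..K}"
  shows "D k \<in> sets borel"
  using assms by (auto simp: domain_partition_def domain_def)

text \<open>At each point at most one indicator is nonzero, by disjointness. Points in no subdomain
  lie either outside \<Omega>, where \<open>v\<close> vanishes almost everywhere, or on the null set
  of interfaces.\<close>

lemma sum_restr_domain_partition:
  assumes \<Omega>: "\<Omega> \<in> sets borel" and D: "domain_partition \<Omega> K D" and v: "v \<in> L2_on \<Omega>"
  shows "v = (\<Sum>k\<in>{1..K}. restr (D k) v)"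
proof -
  note Dk = domain_partition_sets_borel[OF D]
  have si: "square_integrable (\<lambda>x. indicator (D k) x *\<^sub>R fn v x)" if "k \<in> {1..K}" for k
    using that by (intro square_integrable_indicator[OF square_integrable_fn Dk])
  define N where "N = \<Omega> - (\<Union>k\<in>{1..K}. D k)"
  have "N \<in> sets lborel" unfolding N_def using \<Omega> Dk by auto
  \<comment> \<open>\<open>negligible\<close> speaks of Lebesgue measure; as \<open>N\<close> is
    Borel, it is also null for \<open>lborel\<close>.\<close>
  moreover have "N \<in> null_sets lebesgue"
    using D by (simp add: N_def domain_partition_def negligible_iff_null_sets)
  ultimately have "N \<in> null_sets lborel" by (simp add: null_sets_completion_iff)
  then have "AE x in lborel. x \<notin> N" by (rule AE_not_in)
  moreover have "AE x in lborel. x \<notin> \<Omega> \<longrightarrow> fn v x = 0" using v by (simp add: L2_on_def)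
  ultimately have "AE x in lborel. fn v x = (\<Sum>k\<in>{1..K}. indicator (D k) x *\<^sub>R fn v x)"
  proof eventually_elim
    case (elim x)
    have "(\<Sum>k\<in>{1..K}. indicator (D k) x *\<^sub>R fn v x) = indicator (\<Union>k\<in>{1..K}. D k) x *\<^sub>R fn v x"
      using D by (simp add: domain_partition_def indicator_UN_disjoint scaleR_left.sum)
    also have "\<dots> = fn v x" using elim by (auto simp: N_def indicator_def)
    finally show ?case by simp
  qed
  from to_l2_cong_AE[OF square_integrable_fn square_integrable_sum[OF si] this]
  have "v = to_l2 (\<lambda>x. \<Sum>k\<in>{1..K}. indicator (D k) x *\<^sub>R fn v x)" by (simp only: to_l2_fn)
  also have "\<dots> = (\<Sum>k\<in>{1..K}. restr (D k) v)" unfolding restr_def using si by (rule to_l2_sum)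
  finally show ?thesis .
qed

text \<open>The space is an intersection of preimages of subspaces under the linear maps
  \<open>restr (D k)\<close>. Every element is the sum of its restrictions, so the union of the
  local generating sets spans it.\<close>

lemma finite_dim_subspace_broken_space:
  assumes \<Omega>: "\<Omega> \<in> sets borel" and D: "domain_partition \<Omega> K D"
    and V: "\<And>k. k \<in> {1..K} \<Longrightarrow> finite_dim_subspace (V k)"
  shows "finite_dim_subspace (broken_space \<Omega> K D V)"
  unfolding finite_dim_subspace_def
proof
  have "linear (restr (D k) :: 'a l2 \<Rightarrow> _)" if "k \<in> {1..K}" for k
    using domain_partition_sets_borel[OF D that] by (rule linear_restr)
  moreover have "subspace (V k)" if "k \<in> {1..K}" for k
    using V[OF that] by (simp add: finite_dim_subspace_def)
  ultimately have "subspace {v. restr (D k) v \<in> V k}" if "k \<in> {1..K}" for k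
    using that linear_subspace_vimage by (fastforce simp: vimage_def)
  then have "subspace (L2_on \<Omega> \<inter> (\<Inter>k\<in>{1..K}. {v. restr (D k) v \<in> V k}))"
    by (intro subspace_inter subspace_Inter subspace_L2_on \<Omega>) auto
  also have "L2_on \<Omega> \<inter> (\<Inter>k\<in>{1..K}. {v. restr (D k) v \<in> V k}) = broken_space \<Omega> K D V"
    by (auto simp: broken_space_def)
  finally show "subspace (broken_space \<Omega> K D V)" .
  have "\<forall>k\<in>{1..K}. \<exists>B. finite B \<and> V k \<subseteq> span B"
    using V by (simp add: finite_dim_subspace_def)
  then obtain B where B: "\<And>k. k \<in> {1..K} \<Longrightarrow> finite (B k)" "\<And>k. k \<in> {1..K} \<Longrightarrow> V k \<subseteq> span (B k)"
    using bchoice[of "{1..K}" "\<lambda>k B. finite B \<and> V k \<subseteq> span B"] by blast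
  have "v \<in> span (\<Union>k\<in>{1..K}. B k)" if v: "v \<in> broken_space \<Omega> K D V" for v
  proof -
    have "restr (D k) v \<in> span (\<Union>k\<in>{1..K}. B k)" if k: "k \<in> {1..K}" for k
    proof -
      have "span (B k) \<subseteq> span (\<Union>k\<in>{1..K}. B k)" using k by (intro span_mono) blast
      moreover have "restr (D k) v \<in> V k" using v k by (simp add: broken_space_def)
      ultimately show ?thesis using B(2)[OF k] by blast
    qed
    then have "(\<Sum>k\<in>{1..K}. restr (D k) v) \<in> span (\<Union>k\<in>{1..K}. B k)"
      by (rule span_sum)
    then show ?thesis
      using sum_restr_domain_partition[OF \<Omega> D, of v] v by (simp add: broken_space_def)
  qed
  then show "\<exists>B. finite B \<and> broken_space \<Omega> K D V \<subseteq> span B"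
    using B(1) by (intro exI[of _ "\<Union>k\<in>{1..K}. B k"]) auto
qed

section \<open>Test functions and their closure\<close>

lemma integrable_continuous_compact_support:
  fixes g :: "'a::euclidean_space \<Rightarrow> 'b::{banach, second_countable_topology}"
  assumes "continuous_on UNIV g" "compact S" "\<And>x. x \<notin> S \<Longrightarrow> g x = 0"
  shows "integrable lborel g"
proof -
  have "integrable lborel (\<lambda>x. indicator S x *\<^sub>R g x)"
    using assms by (intro borel_integrable_compact) (auto intro: continuous_on_subset)
  moreover have "(\<lambda>x. indicator S x *\<^sub>R g x) = g"
    using assms(3) by (auto simp: indicator_def)
  ultimately show ?thesis by simp
qed

lemma integral_lborel_translate:
  fixes g :: "'a::euclidean_space \<Rightarrow> real"
  assumes [measurable]: "g \<in> borel_measurable borel"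
  shows "(\<integral>x. g (c + x) \<partial>lborel) = (\<integral>x. g x \<partial>lborel)"
proof -
  have "(\<integral>x. g x \<partial>lborel) = (\<integral>x. g x \<partial>distr lborel borel ((+) c))"
    by (simp add: lborel_distr_plus)
  also have "\<dots> = (\<integral>x. g (c + x) \<partial>lborel)"
    by (rule integral_distr) simp_all
  finally show ?thesis by simp
qed

text \<open>By translation invariance the difference quotients in direction \<^term>\<open>e\<close> have integral zero;
  dominated convergence passes to the limit.\<close>

lemma integral_directional_derivative_eq_0:
  fixes g :: "'a::euclidean_space \<Rightarrow> real" and e :: 'a
  assumes der: "\<And>x. (g has_derivative g' x) (at x)"
    and cont: "continuous_on UNIV (\<lambda>x. g' x e)"
    and S: "compact S" and supp: "\<And>x. x \<notin> S \<Longrightarrow> g x = 0"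
  shows "(\<integral>x. g' x e \<partial>lborel) = 0"
proof -
  obtain R where "\<forall>x\<in>S. norm x \<le> R"
    using compact_imp_bounded[OF S] by (auto simp: bounded_iff)
  then have R: "S \<subseteq> cball 0 R" by auto
  have contg: "continuous_on UNIV g"
    using der by (meson continuous_at_imp_continuous_on has_derivative_continuous)
  then have [measurable]: "g \<in> borel_measurable borel"
    by (rule borel_measurable_continuous_onI)
  have [measurable]: "(\<lambda>x. g' x e) \<in> borel_measurable borel"
    using cont by (rule borel_measurable_continuous_onI)
  \<comment> \<open>Outside this ball neither a point nor its shift by at most \<open>e\<close>
    meets the support, so all difference quotients vanish there.\<close>
  define Q where "Q = cball (0::'a) (R + norm e)"
  \<comment> \<open>The mean value theorem evaluates the derivative up to \<open>norm e\<close> away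
    from \<open>Q\<close>, hence the factor 2 in the radius.\<close>
  have "compact ((\<lambda>x. g' x e) ` cball 0 (R + 2 * norm e))"
    by (intro compact_continuous_image continuous_on_subset[OF cont]) auto
  then obtain M where M: "\<And>x. x \<in> cball 0 (R + 2 * norm e) \<Longrightarrow> norm (g' x e) \<le> M"
    by (meson bounded_iff compact_imp_bounded imageI)
  \<comment> \<open>Difference quotients with step \<open>1 / Suc n\<close>, which is positive and
    at most 1 already for \<open>n = 0\<close>.\<close>
  define q where "q n x = (g (x + (1 / Suc n) *\<^sub>R e) - g x) * Suc n" for n :: nat and x
  have bound: "norm (q n x) \<le> indicator Q x * M" for n x
  proof (cases "x \<in> Q")
    case True
    define h where "h = 1 / real (Suc n)"
    have h: "0 < h" "h \<le> 1" by (auto simp: h_def)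
    have "((\<lambda>t. g (x + t *\<^sub>R e)) has_derivative (\<lambda>s. g' (x + t *\<^sub>R e) (s *\<^sub>R e))) (at t within {0..h})" for t
      by (rule has_derivative_compose[OF _ der]) (auto intro!: derivative_eq_intros)
    from mvt_simple[OF h(1) this] obtain t where t: "t \<in> {0<..<h}"
      and eq: "g (x + h *\<^sub>R e) - g (x + 0 *\<^sub>R e) = g' (x + t *\<^sub>R e) ((h - 0) *\<^sub>R e)"
      by blast
    have "norm (x + t *\<^sub>R e) \<le> norm x + t * norm e"
      using t norm_triangle_ineq[of x "t *\<^sub>R e"] by simp
    also have "\<dots> \<le> (R + norm e) + 1 * norm e"
      using True t h by (intro add_mono mult_right_mono) (auto simp: Q_def)
    finally have "norm (g' (x + t *\<^sub>R e) e) \<le> M" by (intro M) simp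
    moreover have "g' (x + t *\<^sub>R e) (h *\<^sub>R e) = h * g' (x + t *\<^sub>R e) e"
      using linear_scale[OF has_derivative_linear[OF der]] by simp
    ultimately show ?thesis
      using True eq by (simp add: q_def h_def[symmetric] abs_mult)
         (simp add: h_def)
  next
    case False
    have "norm x - norm e \<le> norm (x + (1 / Suc n) *\<^sub>R e)"
    proof -
      have "norm x \<le> norm (x + (1 / Suc n) *\<^sub>R e) + norm ((1 / Suc n) *\<^sub>R e)"
        using norm_triangle_ineq4[of "x + (1 / Suc n) *\<^sub>R e" "(1 / Suc n) *\<^sub>R e"] by simp
      also have "norm ((1 / Suc n) *\<^sub>R e) \<le> 1 * norm e"
        unfolding norm_scaleR by (intro mult_right_mono) auto
      finally show ?thesis by simp
    qed
    moreover have "R + norm e < norm x" using False by (simp add: Q_def)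
    ultimately have "R < norm x" "R < norm (x + (1 / Suc n) *\<^sub>R e)"
      using norm_ge_zero[of e] by linarith+
    then have "x \<notin> S" "x + (1 / Suc n) *\<^sub>R e \<notin> S"
      using R by auto
    then show ?thesis using False by (simp add: q_def supp)
  qed
  have lim: "(\<lambda>n. q n x) \<longlonglongrightarrow> g' x e" for x
  proof -
    have "((\<lambda>t. g (x + t *\<^sub>R e)) has_derivative (\<lambda>s. g' (x + 0 *\<^sub>R e) (s *\<^sub>R e))) (at 0)"
      by (rule has_derivative_compose[OF _ der]) (auto intro!: derivative_eq_intros)
    moreover have "(\<lambda>s. g' (x + 0 *\<^sub>R e) (s *\<^sub>R e)) = (\<lambda>s. g' x e * s)"
      using linear_scale[OF has_derivative_linear[OF der[of x]]] by (auto simp: mult.commute)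
    ultimately have "DERIV (\<lambda>t. g (x + t *\<^sub>R e)) 0 :> g' x e"
      by (simp add: has_field_derivative_def)
    then have "((\<lambda>t. (g (x + t *\<^sub>R e) - g x) / t) \<longlongrightarrow> g' x e) (at 0)"
      by (simp add: DERIV_def)
    moreover have "filterlim (\<lambda>n. 1 / real (Suc n)) (at 0) sequentially"
      unfolding filterlim_at using LIMSEQ_inverse_real_of_nat
      by (auto simp: inverse_eq_divide)
    ultimately have "(\<lambda>n. (g (x + (1 / Suc n) *\<^sub>R e) - g x) / (1 / Suc n)) \<longlonglongrightarrow> g' x e"
      by (rule filterlim_compose)
    then show ?thesis by (simp add: q_def)
  qed
  have intg: "integrable lborel g"
    using contg S supp by (rule integrable_continuous_compact_support)
  have "(\<integral>x. q n x \<partial>lborel) = 0" for n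
  proof -
    have "integrable lborel (\<lambda>x. g (x + (1 / Suc n) *\<^sub>R e))"
    proof (rule integrable_continuous_compact_support)
      show "continuous_on UNIV (\<lambda>x. g (x + (1 / Suc n) *\<^sub>R e))"
        by (rule continuous_on_compose2[OF contg]) (auto intro!: continuous_intros)
      show "compact ((\<lambda>x. x - (1 / Suc n) *\<^sub>R e) ` S)"
        using S by (intro compact_continuous_image continuous_intros)
      show "g (x + (1 / Suc n) *\<^sub>R e) = 0" if "x \<notin> (\<lambda>x. x - (1 / Suc n) *\<^sub>R e) ` S" for x
        using that by (intro supp) force
    qed
    then show ?thesis
      using intg integral_lborel_translate[of g "(1 / Suc n) *\<^sub>R e"]
      by (simp add: q_def add.commute)
  qed
  moreover have "(\<lambda>n. \<integral>x. q n x \<partial>lborel) \<longlonglongrightarrow> (\<integral>x. g' x e \<partial>lborel)"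
  proof (rule integral_dominated_convergence[where w = "\<lambda>x. indicator Q x * M"])
    show "integrable lborel (\<lambda>x. indicator Q x * M)"
      by (auto intro!: integrable_mult_left emeasure_compact_finite simp: Q_def)
    show "q n \<in> borel_measurable lborel" for n
      unfolding q_def by measurable
  qed (use bound lim in auto)
  ultimately show ?thesis by (simp add: LIMSEQ_const_iff)
qed

section \<open>Regularity and support of test functions\<close>

lemma partial_eq_0_on_open:
  assumes "open U" "x \<in> U" "\<And>y. y \<in> U \<Longrightarrow> f y = 0"
  shows "partial i f x = 0"
proof -
  have "(f has_derivative (\<lambda>_. 0)) (at x)"
    by (rule has_derivative_transform_within_open[of "\<lambda>_. 0" _ _ _ U]) (use assms in auto)
  then show ?thesis
    by (metis frechet_derivative_at partial_def)
qed

lemma test_functions_has_derivative: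
  assumes "\<phi> \<in> test_functions D"
  shows "(\<phi> has_derivative frechet_derivative \<phi> (at x)) (at x)"
proof -
  have "Ck (Suc 0) \<phi>" using assms unfolding test_functions_def by blast
  then show ?thesis by (simp add: differentiable_on_def frechet_derivative_works)
qed

text \<open>The complement of the support is open, so differentiating there gives zero and the
  support cannot grow. Smoothness is the recursion of \<open>Ck\<close> read one order
  higher.\<close>

lemma test_functions_partial:
  assumes "\<phi> \<in> test_functions D"
  shows "partial i \<phi> \<in> test_functions D"
proof -
  let ?S = "closure {x. \<phi> x \<noteq> 0}"
  have "Ck n (partial i \<phi>)" for n
  proof -
    have "Ck (Suc n) \<phi>" using assms unfolding test_functions_def by blast
    then show ?thesis by simp
  qed
  moreover have "{x. partial i \<phi> x \<noteq> 0} \<subseteq> ?S"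
    using partial_eq_0_on_open[of "- ?S" _ \<phi>] closure_subset[of "{x. \<phi> x \<noteq> 0}"] by blast
  then have "closure {x. partial i \<phi> x \<noteq> 0} \<subseteq> ?S" by (rule closure_minimal) simp
  ultimately show ?thesis
    using assms unfolding test_functions_def
    by (auto simp: compact_eq_bounded_closed intro: bounded_subset)
qed

lemma test_functions_continuous_on:
  assumes "\<phi> \<in> test_functions D"
  shows "continuous_on UNIV \<phi>"
proof -
  have "Ck 0 \<phi>" using assms unfolding test_functions_def by blast
  then show ?thesis by simp
qed

lemma test_functions_compact_support:
  "\<phi> \<in> test_functions D \<Longrightarrow> compact (closure {x. \<phi> x \<noteq> 0})"
  by (simp add: test_functions_def)

lemma outside_support:
  assumes "x \<notin> closure {x. \<phi> x \<noteq> 0}"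
  shows "\<phi> x = 0" and "partial i \<phi> x = 0" and "partial i (partial j \<phi>) x = 0"
proof -
  let ?S = "closure {x. \<phi> x \<noteq> 0}"
  have 0: "\<phi> y = 0" if "y \<notin> ?S" for y
    using that closure_subset[of "{x. \<phi> x \<noteq> 0}"] by blast
  have 1: "partial j \<phi> y = 0" if "y \<notin> ?S" for j y
    by (rule partial_eq_0_on_open[OF open_Compl[OF closed_closure] iffD2[OF Compl_iff that]])
       (rule 0, erule ComplD)
  have 2: "partial i (partial j \<phi>) y = 0" if "y \<notin> ?S" for i j y
    by (rule partial_eq_0_on_open[OF open_Compl[OF closed_closure] iffD2[OF Compl_iff that]])
       (rule 1, erule ComplD)
  show "\<phi> x = 0" "partial i \<phi> x = 0" "partial i (partial j \<phi>) x = 0"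
    using assms by (rule 0 1 2)+
qed

lemma square_integrable_continuous_compact_support:
  fixes g :: "real^3 \<Rightarrow> 'b::euclidean_space"
  assumes "continuous_on UNIV g" "compact S" "\<And>x. x \<notin> S \<Longrightarrow> g x = 0"
  shows "square_integrable g"
  unfolding square_integrable_def
proof
  show "g \<in> borel_measurable lborel"
    using borel_measurable_continuous_onI[OF assms(1)] by simp
  show "integrable lborel (\<lambda>x. (norm (g x))\<^sup>2)"
    by (rule integrable_continuous_compact_support[OF _ assms(2)])
       (auto intro!: continuous_intros assms(1) simp: assms(3))
qed

section \<open>Green's formula and the gradient on \<open>H10\<close>\<close>

definition laplacian :: "(real^3 \<Rightarrow> real) \<Rightarrow> real^3 \<Rightarrow> real" where
  "laplacian f x = (\<Sum>i\<in>UNIV. partial i (partial i f) x)"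

lemma square_integrable_test_function:
  assumes "\<phi> \<in> test_functions D"
  shows "square_integrable \<phi>"
proof -
  show ?thesis
    by (rule square_integrable_continuous_compact_support[OF test_functions_continuous_on
          test_functions_compact_support outside_support(1)]) (use assms in auto)
qed

lemma square_integrable_classical_grad:
  assumes "\<phi> \<in> test_functions D"
  shows "square_integrable (classical_grad \<phi>)"
proof -
  define supp where "supp = closure {x. \<phi> x \<noteq> 0}"
  note S = test_functions_compact_support[OF assms, folded supp_def]
    outside_support[of _ \<phi>, folded supp_def]
  show ?thesis
  proof (rule square_integrable_continuous_compact_support[OF _ S(1)])
    have eq: "classical_grad \<phi> = (\<lambda>x. \<chi> i. partial i \<phi> x)"
      by (rule ext) (rule classical_grad_def)
    have "continuous_on UNIV (partial i \<phi>)" for i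
       by (rule test_functions_continuous_on[OF test_functions_partial[OF assms]])
    then have "continuous_on UNIV (\<lambda>x. \<chi> i. partial i \<phi> x)"
      by (rule continuous_on_vec_lambda)
    then show "continuous_on UNIV (classical_grad \<phi>)"
      unfolding eq .
    show "classical_grad \<phi> x = 0" if "x \<notin> supp" for x
      unfolding classical_grad_def S(3)[OF that] zero_vec_def ..
  qed
qed
lemma square_integrable_laplacian:
  assumes "\<phi> \<in> test_functions D"
  shows "square_integrable (laplacian \<phi>)"
proof -
  define supp where "supp = closure {x. \<phi> x \<noteq> 0}"
  note S = test_functions_compact_support[OF assms, folded supp_def]
    outside_support[of _ \<phi>, folded supp_def]
  show ?thesis
  proof (rule square_integrable_continuous_compact_support[OF _ S(1)])
    show "continuous_on UNIV (laplacian \<phi>)"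
      unfolding laplacian_def
      by (intro continuous_intros test_functions_continuous_on)
         (intro test_functions_partial, rule assms)
  qed (simp add: laplacian_def S(4))
qed

text \<open>For each coordinate the derivative of \<open>\<phi>\<close> times
  \<open>partial i \<eta>\<close> integrates to zero; summing over the coordinates gives the
  formula. The support of \<open>\<phi>\<close> also contains that of each product.\<close>

lemma green_test_functions:
  assumes \<phi>: "\<phi> \<in> test_functions D" and \<eta>: "\<eta> \<in> test_functions D'"
  shows "to_l2 (classical_grad \<phi>) \<bullet> to_l2 (classical_grad \<eta>) = - (to_l2 \<phi> \<bullet> to_l2 (laplacian \<eta>))"
proof -
  define supp where "supp = closure {x. \<phi> x \<noteq> 0}"
  note S = test_functions_compact_support[OF \<phi>, folded supp_def]
    outside_support[of _ \<phi>, folded supp_def]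
  note cont = test_functions_continuous_on[OF \<phi>]
    test_functions_continuous_on[OF test_functions_partial[OF \<phi>]]
    test_functions_continuous_on[OF test_functions_partial[OF \<eta>]]
    test_functions_continuous_on[OF test_functions_partial[OF test_functions_partial[OF \<eta>]]]
  define F where "F i x = partial i \<phi> x * partial i \<eta> x + \<phi> x * partial i (partial i \<eta>) x" for i x
  have contF: "continuous_on UNIV (F i)" for i
    unfolding F_def by (intro continuous_intros cont)
  have intF: "integrable lborel (F i)" for i
    by (rule integrable_continuous_compact_support[OF contF S(1)]) (simp add: F_def S)
  have zero: "(\<integral>x. F i x \<partial>lborel) = 0" for i
  proof -
    define g' where "g' x s = \<phi> x * frechet_derivative (partial i \<eta>) (at x) s +
      frechet_derivative \<phi> (at x) s * partial i \<eta> x" for x s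
    have F: "F i x = g' x (axis i 1)" for x
      by (simp add: F_def g'_def partial_def)
    have der: "((\<lambda>x. \<phi> x * partial i \<eta> x) has_derivative g' x) (at x)" for x
      unfolding g'_def
      by (rule has_derivative_mult[OF test_functions_has_derivative[OF \<phi>]
            test_functions_has_derivative[OF test_functions_partial[OF \<eta>]]])
    show ?thesis
      unfolding F
    proof (rule integral_directional_derivative_eq_0[OF der _ S(1)])
      show "continuous_on UNIV (\<lambda>x. g' x (axis i 1))"
        unfolding F[symmetric] by (rule contF)
    qed (simp add: S(2))
  qed
  have si: "square_integrable (classical_grad \<phi>)" "square_integrable (classical_grad \<eta>)"
    "square_integrable \<phi>" "square_integrable (laplacian \<eta>)"
    using \<phi> \<eta> by (auto intro: square_integrable_classical_grad square_integrable_test_function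
        square_integrable_laplacian)
  have "to_l2 (classical_grad \<phi>) \<bullet> to_l2 (classical_grad \<eta>) + to_l2 \<phi> \<bullet> to_l2 (laplacian \<eta>) =
      (\<integral>x. classical_grad \<phi> x \<bullet> classical_grad \<eta> x + \<phi> x \<bullet> laplacian \<eta> x \<partial>lborel)"
    unfolding inner_to_l2[OF si(1,2)] inner_to_l2[OF si(3,4)]
    by (rule Bochner_Integration.integral_add[symmetric])
       (rule integrable_inner_square_integrable, rule si, rule si)+
  also have "\<dots> = (\<integral>x. (\<Sum>i\<in>UNIV. F i x) \<partial>lborel)"
    by (simp add: classical_grad_def laplacian_def F_def inner_vec_def sum.distrib sum_distrib_left)
  also have "\<dots> = 0"
    using intF zero by simp
  finally show ?thesis by simp
qed

lemma H10_approx: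
  assumes "u \<in> H10 \<Omega>"
  shows "\<exists>\<phi>. (\<forall>n::nat. \<phi> n \<in> test_functions \<Omega>) \<and> (\<lambda>n. to_l2 (\<phi> n)) \<longlonglongrightarrow> u \<and>
    (\<lambda>n. to_l2 (classical_grad (\<phi> n))) \<longlonglongrightarrow> grad \<Omega> u"
  using assms unfolding H10_def by blast

text \<open>With \<eta> fixed, one side is continuous in the gradient of the approximating functions
  and the other in the functions themselves. Both converge in the definition of \<open>H10\<close>,
  so the formula passes to the limit.\<close>

lemma green_H10:
  assumes "u \<in> H10 \<Omega>" "\<eta> \<in> test_functions \<Omega>"
  shows "grad \<Omega> u \<bullet> to_l2 (classical_grad \<eta>) = - (u \<bullet> to_l2 (laplacian \<eta>))"
proof -
  obtain \<phi> where \<phi>: "\<And>n::nat. \<phi> n \<in> test_functions \<Omega>" "(\<lambda>n. to_l2 (\<phi> n)) \<longlonglongrightarrow> u"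
    "(\<lambda>n. to_l2 (classical_grad (\<phi> n))) \<longlonglongrightarrow> grad \<Omega> u"
    using H10_approx[OF assms(1)] by blast
  have "(\<lambda>n. to_l2 (classical_grad (\<phi> n)) \<bullet> to_l2 (classical_grad \<eta>))
      \<longlonglongrightarrow> grad \<Omega> u \<bullet> to_l2 (classical_grad \<eta>)"
    by (intro tendsto_intros \<phi>)
  moreover have "(\<lambda>n. to_l2 (classical_grad (\<phi> n)) \<bullet> to_l2 (classical_grad \<eta>))
      \<longlonglongrightarrow> - (u \<bullet> to_l2 (laplacian \<eta>))"
    unfolding green_test_functions[OF \<phi>(1) assms(2)] by (intro tendsto_intros \<phi>)
  ultimately show ?thesis by (rule LIMSEQ_unique)
qed

text \<open>The defect of linearity is orthogonal to all gradients of test functions by Green's formula,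
  and it is a limit of such gradients.  Thus uniqueness of weak gradients is not needed.\<close>

lemma grad_H10_linear:
  assumes u: "u \<in> H10 \<Omega>" and v: "v \<in> H10 \<Omega>" and w: "a *\<^sub>R u + b *\<^sub>R v \<in> H10 \<Omega>"
  shows "grad \<Omega> (a *\<^sub>R u + b *\<^sub>R v) = a *\<^sub>R grad \<Omega> u + b *\<^sub>R grad \<Omega> v"
proof -
  define d where "d = grad \<Omega> (a *\<^sub>R u + b *\<^sub>R v) - (a *\<^sub>R grad \<Omega> u + b *\<^sub>R grad \<Omega> v)"
  \<comment> \<open>Green's formula turns all three pairings into pairings with one fixed Laplacian,
    where the combination cancels.\<close>
  have orth: "d \<bullet> to_l2 (classical_grad \<eta>) = 0" if "\<eta> \<in> test_functions \<Omega>" for \<eta>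
    using green_H10[OF u that] green_H10[OF v that] green_H10[OF w that]
    by (simp add: d_def inner_diff_left inner_add_left algebra_simps)
  obtain \<phi> where \<phi>: "\<And>n::nat. \<phi> n \<in> test_functions \<Omega>"
    "(\<lambda>n. to_l2 (classical_grad (\<phi> n))) \<longlonglongrightarrow> grad \<Omega> u"
    using H10_approx[OF u] by blast
  obtain \<psi> where \<psi>: "\<And>n::nat. \<psi> n \<in> test_functions \<Omega>"
    "(\<lambda>n. to_l2 (classical_grad (\<psi> n))) \<longlonglongrightarrow> grad \<Omega> v"
    using H10_approx[OF v] by blast
  obtain \<eta> where \<eta>: "\<And>n::nat. \<eta> n \<in> test_functions \<Omega>"
    "(\<lambda>n. to_l2 (classical_grad (\<eta> n))) \<longlonglongrightarrow> grad \<Omega> (a *\<^sub>R u + b *\<^sub>R v)"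
    using H10_approx[OF w] by blast
  have "(\<lambda>n. d \<bullet> (to_l2 (classical_grad (\<eta> n)) - (a *\<^sub>R to_l2 (classical_grad (\<phi> n)) +
      b *\<^sub>R to_l2 (classical_grad (\<psi> n))))) \<longlonglongrightarrow> d \<bullet> d"
    by (subst (2) d_def) (intro tendsto_intros \<phi> \<psi> \<eta>)
  then have "d \<bullet> d = 0"
    using \<phi>(1) \<psi>(1) \<eta>(1) by (simp add: inner_diff_right inner_add_right orth LIMSEQ_const_iff)
  then show ?thesis by (simp add: d_def)
qed

section \<open>Weighted Poincare inequality and injectivity of the gradient\<close>

lemma norm_to_l2_power2:
  assumes "square_integrable f"
  shows "(norm (to_l2 f))\<^sup>2 = (\<integral>x. (norm (f x))\<^sup>2 \<partial>lborel)"
  using inner_to_l2[OF assms assms] by (simp add: power2_norm_eq_inner)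

lemma norm_to_l2_le:
  assumes "square_integrable f" "square_integrable g" "0 \<le> c"
    and "\<And>x. norm (f x) \<le> c * norm (g x)"
  shows "norm (to_l2 f) \<le> c * norm (to_l2 g)"
proof (rule power2_le_imp_le)
  have "(norm (to_l2 f))\<^sup>2 \<le> (\<integral>x. c\<^sup>2 * (norm (g x))\<^sup>2 \<partial>lborel)"
    unfolding norm_to_l2_power2[OF assms(1)]
  proof (rule integral_mono)
    show "(norm (f x))\<^sup>2 \<le> c\<^sup>2 * (norm (g x))\<^sup>2" for x
      using power_mono[OF assms(4)[of x], of 2] by (simp add: power_mult_distrib)
  qed (use assms(1,2) in \<open>auto simp: square_integrable_def\<close>)
  then show "(norm (to_l2 f))\<^sup>2 \<le> (c * norm (to_l2 g))\<^sup>2"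
    by (simp add: norm_to_l2_power2[OF assms(2)] power_mult_distrib)
qed (use assms(3) in simp)

text \<open>The arctangent is bounded while its derivative is positive everywhere: the derivative
  produces the weight, and the bound produces a constant independent of the support of
  \<open>\<phi>\<close>.\<close>

lemma weighted_poincare_test_function:
  fixes \<phi> :: "real^3 \<Rightarrow> real"
  assumes \<phi>: "\<phi> \<in> test_functions D"
  shows "(\<integral>x. (\<phi> x)\<^sup>2 / (1 + (x $ 1)\<^sup>2) \<partial>lborel) \<le> pi * norm (to_l2 \<phi>) * norm (to_l2 (classical_grad \<phi>))"
proof -
  define supp where "supp = closure {x. \<phi> x \<noteq> 0}"
  note S = test_functions_compact_support[OF \<phi>, folded supp_def]
    outside_support[of _ \<phi>, folded supp_def]
  note cont = test_functions_continuous_on[OF \<phi>]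
    test_functions_continuous_on[OF test_functions_partial[OF \<phi>]]
  \<comment> \<open>The product rule for \<open>arctan (x $ 1) * (\<phi> x)\<^sup>2\<close> has one
    term besides the weight. \<open>Y\<close> is chosen so that its inner product with the gradient
    is the negative of that term; this turns the vanishing integral into an identity to which
    Cauchy-Schwarz applies.\<close>
  define Y :: "real^3 \<Rightarrow> real^3" where "Y x = (- 2 * arctan (x $ 1) * \<phi> x) *\<^sub>R axis 1 1" for x
  have nz: "1 + (t::real)\<^sup>2 \<noteq> 0" for t
    using zero_le_power2[of t] by linarith
  have Y: "square_integrable Y"
    by (rule square_integrable_continuous_compact_support[OF _ S(1)])
       (auto simp: Y_def S intro!: continuous_intros cont)
  define w where "w x = (\<phi> x)\<^sup>2 / (1 + (x $ 1)\<^sup>2)" for x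
  have contw: "continuous_on UNIV w"
    unfolding w_def by (intro continuous_intros cont) (simp add: nz)
  have intw: "integrable lborel w"
    by (rule integrable_continuous_compact_support[OF contw S(1)]) (simp add: w_def S)
  have YG: "Y x \<bullet> classical_grad \<phi> x = - 2 * arctan (x $ 1) * \<phi> x * partial 1 \<phi> x" for x
    by (simp add: Y_def classical_grad_def inner_axis')
  define g' where "g' x s = arctan (x $ 1) * (2 * \<phi> x * frechet_derivative \<phi> (at x) s) +
      (s $ 1 / (1 + (x $ 1)\<^sup>2)) * (\<phi> x)\<^sup>2" for x and s :: "real^3"
  have g': "g' x (axis 1 1) = w x - Y x \<bullet> classical_grad \<phi> x" for x
    by (simp add: g'_def YG w_def partial_def axis_def)
  have "(\<integral>x. g' x (axis 1 1) \<partial>lborel) = 0"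
  proof (rule integral_directional_derivative_eq_0[OF _ _ S(1)])
    fix x
    have 1: "((\<lambda>x::real^3. arctan (x $ 1)) has_derivative (\<lambda>s. s $ 1 / (1 + (x $ 1)\<^sup>2))) (at x)"
      by (auto intro!: derivative_eq_intros bounded_linear_imp_has_derivative bounded_linear_vec_nth
          simp: divide_inverse)
    have 2: "((\<lambda>x. (\<phi> x)\<^sup>2) has_derivative (\<lambda>s. 2 * \<phi> x * frechet_derivative \<phi> (at x) s)) (at x)"
      using has_derivative_power[OF test_functions_has_derivative[OF \<phi>, of x], of 2]
      by (simp add: algebra_simps)
    show "((\<lambda>x. arctan (x $ 1) * (\<phi> x)\<^sup>2) has_derivative g' x) (at x)"
      unfolding g'_def using has_derivative_mult[OF 1 2] .
  next
    show "continuous_on UNIV (\<lambda>x. g' x (axis 1 1))"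
      unfolding g' YG by (intro continuous_intros contw cont)
  qed (simp add: S)
  then have "(\<integral>x. w x \<partial>lborel) = (\<integral>x. Y x \<bullet> classical_grad \<phi> x \<partial>lborel)"
    unfolding g' using intw integrable_inner_square_integrable[OF Y square_integrable_classical_grad[OF \<phi>]]
    by (simp add: Bochner_Integration.integral_diff)
  also have "\<dots> = to_l2 Y \<bullet> to_l2 (classical_grad \<phi>)"
    using Y square_integrable_classical_grad[OF \<phi>] by (simp add: inner_to_l2)
  also have "\<dots> \<le> norm (to_l2 Y) * norm (to_l2 (classical_grad \<phi>))"
    by (rule norm_cauchy_schwarz)
  also have "\<dots> \<le> (pi * norm (to_l2 \<phi>)) * norm (to_l2 (classical_grad \<phi>))"
  proof (intro mult_right_mono norm_to_l2_le Y square_integrable_test_function[OF \<phi>])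
    show "norm (Y x) \<le> pi * norm (\<phi> x)" for x
    proof -
      \<comment> \<open>The origin of the constant: the arctangent stays between
        \<open>- pi / 2\<close> and \<open>pi / 2\<close>.\<close>
      have "\<bar>2 * arctan (x $ 1)\<bar> \<le> pi"
        using arctan_bounded[of "x $ 1"] by (auto simp: abs_le_iff)
      then show ?thesis
        using mult_right_mono[of "\<bar>2 * arctan (x $ 1)\<bar>" pi "\<bar>\<phi> x\<bar>"] by (simp add: Y_def abs_mult)
    qed
  qed auto
  finally show ?thesis by (simp add: w_def)
qed

text \<open>For the approximating test functions the weighted inequality bounds the weighted
  integral by a convergent norm times a gradient norm tending to 0. Hence the weighted integral of
  the square of \<open>u\<close> is 0, and the weight is positive everywhere.\<close>

lemma grad_H10_eq_0_imp_eq_0: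
  assumes u: "u \<in> H10 \<Omega>" and zero: "grad \<Omega> u = 0"
  shows "u = 0"
proof -
  obtain \<phi> where \<phi>: "\<And>n::nat. \<phi> n \<in> test_functions \<Omega>" "(\<lambda>n. to_l2 (\<phi> n)) \<longlonglongrightarrow> u"
    "(\<lambda>n. to_l2 (classical_grad (\<phi> n))) \<longlonglongrightarrow> 0"
    using H10_approx[OF u] unfolding zero by blast
  define w where "w f x = (f x)\<^sup>2 / (1 + (x $ 1)\<^sup>2)" for f :: "real^3 \<Rightarrow> real" and x :: "real^3"
  have pos: "0 < 1 + (t::real)\<^sup>2" for t
    using zero_le_power2[of t] by linarith
  have w_le: "w f x \<le> (f x)\<^sup>2" "0 \<le> w f x" for f x
    using mult_left_mono[of 1 "1 + (x $ 1)\<^sup>2" "(f x)\<^sup>2"] pos[of "x $ 1"]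
    by (auto simp: w_def divide_le_eq)
  have intw: "integrable lborel (w f)" if "square_integrable f" for f
  proof (rule Bochner_Integration.integrable_bound)
    have [measurable]: "f \<in> borel_measurable lborel"
      using that by (simp add: square_integrable_def)
    show "w f \<in> borel_measurable lborel" unfolding w_def by measurable
    show "integrable lborel (\<lambda>x. (f x)\<^sup>2)"
      using that by (simp add: square_integrable_def)
  qed (use w_le in auto)
  \<comment> \<open>Split \<open>u\<close> into the approximation error and \<open>\<phi> n\<close>:
    on the error the weight is estimated by 1, on \<open>\<phi> n\<close> the weighted inequality
    applies.\<close>
  have bound: "(\<integral>x. w (fn u) x \<partial>lborel) \<le> 2 * (norm (u - to_l2 (\<phi> n)))\<^sup>2 +
      2 * (pi * norm (to_l2 (\<phi> n)) * norm (to_l2 (classical_grad (\<phi> n))))" for n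
  proof -
    let ?d = "\<lambda>x. fn u x + (-1) *\<^sub>R \<phi> n x"
    have si: "square_integrable (\<phi> n)" by (rule square_integrable_test_function[OF \<phi>(1)])
    then have si': "square_integrable (\<lambda>x. (-1) *\<^sub>R \<phi> n x)" by (rule square_integrable_scaleR)
    have d: "square_integrable ?d" by (rule square_integrable_add[OF square_integrable_fn si'])
    have "to_l2 ?d = u - to_l2 (\<phi> n)"
      unfolding to_l2_add[OF square_integrable_fn si'] to_l2_scaleR[OF si] to_l2_fn by simp
    then have n: "(norm (u - to_l2 (\<phi> n)))\<^sup>2 = (\<integral>x. (?d x)\<^sup>2 \<partial>lborel)"
      using norm_to_l2_power2[OF d] by simp
    have intd: "integrable lborel (\<lambda>x. (?d x)\<^sup>2)" using d by (simp add: square_integrable_def)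
    have "(\<integral>x. w (fn u) x \<partial>lborel) \<le> (\<integral>x. 2 * (?d x)\<^sup>2 + 2 * w (\<phi> n) x \<partial>lborel)"
    proof (rule integral_mono)
      fix x
      have "(fn u x)\<^sup>2 \<le> 2 * (?d x)\<^sup>2 + 2 * (\<phi> n x)\<^sup>2"
        \<comment> \<open>The right side minus the left side is exactly this square.\<close>
        using zero_le_power2[of "fn u x - 2 * \<phi> n x"] by (simp add: power2_eq_square algebra_simps)
      then have "w (fn u) x \<le> (2 * (?d x)\<^sup>2 + 2 * (\<phi> n x)\<^sup>2) / (1 + (x $ 1)\<^sup>2)"
        unfolding w_def using pos[of "x $ 1"] by (intro divide_right_mono) auto
      also have "\<dots> = 2 * w ?d x + 2 * w (\<phi> n) x"
        by (simp add: w_def add_divide_distrib)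
      finally show "w (fn u) x \<le> 2 * (?d x)\<^sup>2 + 2 * w (\<phi> n) x"
        using w_le(1)[of ?d x] by linarith
    qed (use intd intw square_integrable_fn si in auto)
    also have "\<dots> = 2 * (\<integral>x. (?d x)\<^sup>2 \<partial>lborel) + 2 * (\<integral>x. w (\<phi> n) x \<partial>lborel)"
      using intd intw[OF si] by (subst Bochner_Integration.integral_add) auto
    finally show ?thesis
      using weighted_poincare_test_function[OF \<phi>(1), of n] by (simp add: n w_def)
  qed
  have "(\<lambda>n. 2 * (norm (u - to_l2 (\<phi> n)))\<^sup>2 +
      2 * (pi * norm (to_l2 (\<phi> n)) * norm (to_l2 (classical_grad (\<phi> n)))))
      \<longlonglongrightarrow> 2 * (norm (u - u))\<^sup>2 + 2 * (pi * norm u * norm (0 :: (real^3) l2))"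
    by (intro tendsto_intros \<phi>)
  then have "(\<integral>x. w (fn u) x \<partial>lborel) \<le> 0"
    using bound by (intro LIMSEQ_le_const) auto
  moreover have "0 \<le> (\<integral>x. w (fn u) x \<partial>lborel)"
    using w_le(2) by (intro integral_nonneg_AE) auto
  ultimately have "(\<integral>x. w (fn u) x \<partial>lborel) = 0" by simp
  then have "AE x in lborel. w (fn u) x = 0"
    using integral_nonneg_eq_0_iff_AE[OF intw[OF square_integrable_fn]] w_le(2) by auto
  then have "AE x in lborel. fn u x = 0"
    by (rule eventually_mono) (simp add: w_def less_imp_neq[OF pos, symmetric])
  then have "to_l2 (fn u) = to_l2 (\<lambda>x. 0)"
    using to_l2_eq_iff[OF square_integrable_fn square_integrable_zero] by blast
  then show ?thesis by (simp add: to_l2_fn zero_l2_def)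
qed

section \<open>The Poisson problem\<close>

theorem proposition3p1:
  fixes \<Omega> :: "(real^3) set" and K :: nat and D :: "nat \<Rightarrow> (real^3) set"
    and V0loc :: "nat \<Rightarrow> real l2 set" and V1loc :: "nat \<Rightarrow> (real^3) l2 set"
    and V0 V0c :: "real l2 set" and P :: "real l2 \<Rightarrow> real l2"
    and f :: "real l2" and \<alpha> :: real
  assumes "domain \<Omega>" and "domain_partition \<Omega> K D"
    and "\<And>k. k \<in> {1..K} \<Longrightarrow> finite_dim_subspace (V0loc k) \<and> V0loc k \<subseteq> H1 (D k)"
    and "\<And>k. k \<in> {1..K} \<Longrightarrow> finite_dim_subspace (V1loc k) \<and> V1loc k \<subseteq> Hcurl (D k)"
    and "\<And>k. k \<in> {1..K} \<Longrightarrow> grad (D k) ` V0loc k \<subseteq> V1loc k"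
    and "V0 = broken_space \<Omega> K D V0loc"
    and "V0c = conforming_space \<Omega> V0"
    and "linear_proj_onto V0 V0c P"
    and "f \<in> L2_on \<Omega>" and "\<alpha> \<noteq> 0"
  shows "(\<exists>!\<phi>. solves_broken_poisson \<Omega> V0 P \<alpha> f \<phi>) \<and>
    (\<forall>\<phi>. solves_broken_poisson \<Omega> V0 P \<alpha> f \<phi> \<longrightarrow>
       \<phi> \<in> V0c \<and>
       (\<forall>\<phi>c\<in>V0c. grad \<Omega> \<phi>c \<bullet> grad \<Omega> \<phi> = \<phi>c \<bullet> f) \<and>
       (\<forall>P' \<alpha>' \<phi>'. linear_proj_onto V0 V0c P' \<and> \<alpha>' \<noteq> 0 \<and>
          solves_broken_poisson \<Omega> V0 P' \<alpha>' f \<phi>' \<longrightarrow> \<phi>' = \<phi>))"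
proof -
  have \<Omega>: "\<Omega> \<in> sets borel" using assms(1) by (simp add: domain_def)
  have V0: "finite_dim_subspace V0"
    unfolding assms(6) using assms(3) by (intro finite_dim_subspace_broken_space \<Omega> assms(2)) blast
  have V0c: "V0c \<subseteq> V0" "V0c \<subseteq> H10 \<Omega>" by (auto simp: assms(7) conforming_space_def)
  have "linear_map_on V0 P" and range: "P ` V0 = V0c"
    using assms(8) by (auto simp: linear_proj_onto_def linear_map_on_def)
  \<comment> \<open>\<open>V0c\<close> is a subspace as the range of \<open>P\<close> on
    \<open>V0\<close>. This puts sums and multiples back into \<open>H10\<close>, as
    \<open>grad_H10_linear\<close> requires.\<close>
  then have W: "finite_dim_subspace V0c"
    using finite_dim_subspace_image[OF _ V0] by metis
  then have sW: "subspace V0c" by (simp add: finite_dim_subspace_def)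
  have G: "linear_map_on V0c (grad \<Omega>)"
    unfolding linear_map_on_def
  proof (intro conjI ballI allI)
    fix u v assume uv: "u \<in> V0c" "v \<in> V0c"
    then have "u + v \<in> V0c" by (rule subspace_add[OF sW])
    then show "grad \<Omega> (u + v) = grad \<Omega> u + grad \<Omega> v"
      using grad_H10_linear[of u \<Omega> v 1 1] uv V0c by auto
  next
    fix c u assume u: "u \<in> V0c"
    then have "c *\<^sub>R u \<in> V0c" by (rule subspace_scale[OF sW])
    then show "grad \<Omega> (c *\<^sub>R u) = c *\<^sub>R grad \<Omega> u"
      using grad_H10_linear[of u \<Omega> u c 0] u V0c by auto
  qed
  \<comment> \<open>Stated for arbitrary \<open>P'\<close> and \<open>\<alpha>'\<close> with the
    same range \<open>V0c\<close>: all these equations share one conforming problem, whose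
    uniqueness gives the independence claim.\<close>
  have iff: "solves_broken_poisson \<Omega> V0 P' \<alpha>' f \<phi> \<longleftrightarrow>
      \<phi> \<in> V0c \<and> (\<forall>u\<in>V0c. grad \<Omega> \<phi> \<bullet> grad \<Omega> u = f \<bullet> u)"
    if "linear_proj_onto V0 V0c P'" "\<alpha>' \<noteq> 0" for P' \<alpha>' \<phi>
    by (rule solves_broken_poisson_iff_conforming[OF V0 that(1) V0c(1) G that(2)])
  have ex1: "\<exists>!\<phi>. \<phi> \<in> V0c \<and> (\<forall>u\<in>V0c. grad \<Omega> \<phi> \<bullet> grad \<Omega> u = f \<bullet> u)"
    using grad_H10_eq_0_imp_eq_0 V0c(2) by (intro conforming_poisson_ex1[OF W G]) blast
  show ?thesis
  proof (intro conjI allI impI ballI)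
    show "\<exists>!\<phi>. solves_broken_poisson \<Omega> V0 P \<alpha> f \<phi>"
      using ex1 by (simp only: iff[OF assms(8,10)])
  next
    fix \<phi> assume "solves_broken_poisson \<Omega> V0 P \<alpha> f \<phi>"
    then have \<phi>: "\<phi> \<in> V0c \<and> (\<forall>u\<in>V0c. grad \<Omega> \<phi> \<bullet> grad \<Omega> u = f \<bullet> u)"
      unfolding iff[OF assms(8,10)] .
    then show "\<phi> \<in> V0c" ..
    show "grad \<Omega> u \<bullet> grad \<Omega> \<phi> = u \<bullet> f" if "u \<in> V0c" for u
      using \<phi> that by (metis inner_commute)
    show "\<phi>' = \<phi>" if "linear_proj_onto V0 V0c P' \<and> \<alpha>' \<noteq> 0 \<and>
        solves_broken_poisson \<Omega> V0 P' \<alpha>' f \<phi>'" for P' \<alpha>' \<phi>'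
      using that iff ex1 \<phi> by blast
  qed
qed

end
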